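(* Let $\Phi$ be a crystallographic reduced root system. Any face $F$ of the root polytope $\mathcal{P}_\Phi$ is normal, i.e. $C(V(F))\cap Z(F)=N(F)$.
   Context: $\Phi$ spans a Euclidean space $E$; the root polytope $\mathcal{P}_\Phi$ is the convex hull of $\Phi$ in $E$. For a face $F$ of $\mathcal{P}_\Phi$: $V(F)=F\cap\Phi$ is the set of roots in $F$; $C(V(F))$ is the set of non-negative rational linear combinations of elements of $V(F)$; $N(F)$ is the $\mathbb{N}$-span of $V(F)$; $Z(F)$ is the $\mathbb{Z}$-span of $V(F)$. *)

theory Defs
  imports "HOL-Analysis.Analysis"
begin

definition refl_coeff :: "'a::euclidean_space \<Rightarrow> 'a \<Rightarrow> real" where
  "refl_coeff \<alpha> \<beta> = 2 * (\<beta> \<bullet> \<alpha>) / (\<alpha> \<bullet> \<alpha>)"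

definition root_reflection :: "'a::euclidean_space \<Rightarrow> 'a \<Rightarrow> 'a" where
  "root_reflection \<alpha> \<beta> = \<beta> - refl_coeff \<alpha> \<beta> *\<^sub>R \<alpha>"

text \<open>
  The Euclidean space spanned by the roots is an arbitrary linear subspace \<open>E\<close> of the ambient
  type. The case \<open>E = UNIV\<close> is included, and so is rank zero (\<open>E = {0}\<close>), which is not the
  universe of any type of class \<open>euclidean_space\<close>.
\<close>

definition root_system :: "'a::euclidean_space set \<Rightarrow> 'a set \<Rightarrow> bool" where
  "root_system E \<Phi> \<longleftrightarrow>
     finite \<Phi> \<and> span \<Phi> = E \<and> 0 \<notin> \<Phi> \<and>
     (\<forall>\<alpha>\<in>\<Phi>. root_reflection \<alpha> ` \<Phi> = \<Phi>)"

definition crystallographic :: "'a::euclidean_space set \<Rightarrow> bool" where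
  "crystallographic \<Phi> \<longleftrightarrow> (\<forall>\<alpha>\<in>\<Phi>. \<forall>\<beta>\<in>\<Phi>. refl_coeff \<alpha> \<beta> \<in> \<int>)"

definition reduced_roots :: "'a::euclidean_space set \<Rightarrow> bool" where
  "reduced_roots \<Phi> \<longleftrightarrow> (\<forall>\<alpha>\<in>\<Phi>. \<Phi> \<inter> range (\<lambda>c. c *\<^sub>R \<alpha>) = {\<alpha>, - \<alpha>})"

definition root_polytope :: "'a::euclidean_space set \<Rightarrow> 'a set" where
  "root_polytope \<Phi> = convex hull \<Phi>"

definition face_roots :: "'a::euclidean_space set \<Rightarrow> 'a set \<Rightarrow> 'a set" where
  "face_roots \<Phi> F = F \<inter> \<Phi>"

definition lin_combs :: "real set \<Rightarrow> 'a::euclidean_space set \<Rightarrow> 'a set" where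
  "lin_combs K V = {\<Sum>v\<in>S. c v *\<^sub>R v | S c. finite S \<and> S \<subseteq> V \<and> (\<forall>v\<in>S. c v \<in> K)}"

definition rat_cone :: "'a::euclidean_space set \<Rightarrow> 'a set" where
  "rat_cone V = lin_combs {q \<in> \<rat>. 0 \<le> q} V"

definition nat_span :: "'a::euclidean_space set \<Rightarrow> 'a set" where
  "nat_span V = lin_combs \<nat> V"

definition int_span :: "'a::euclidean_space set \<Rightarrow> 'a set" where
  "int_span V = lin_combs \<int> V"

definition normal_face :: "'a::euclidean_space set \<Rightarrow> 'a set \<Rightarrow> bool" where
  "normal_face \<Phi> F \<longleftrightarrow>
     rat_cone (face_roots \<Phi> F) \<inter> int_span (face_roots \<Phi> F) = nat_span (face_roots \<Phi> F)"

end

theory Submission imports Defs begin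

text \<open>
  If \<open>F\<close> is the whole polytope, then \<open>V(F) = \<Phi>\<close> is symmetric and \<open>N(F) = Z(F)\<close>. Otherwise some
  linear form \<open>l\<close> satisfies \<open>l \<le> 1\<close> on \<open>\<Phi>\<close> and \<open>V(F) = {\<alpha> \<in> \<Phi>. l \<alpha> = 1}\<close>. On the subsystem
  \<open>\<Psi> = \<Phi> \<inter> Z(F)\<close> the form \<open>l\<close> only takes the values -1, 0, 1. Given \<open>x \<in> C(V(F)) \<inter> Z(F)\<close>, order
  \<open>\<Psi>\<close> by a generic refinement of the lexicographic order \<open>(l, - x)\<close>, so that \<open>V(F)\<close> is positive and
  \<open>x\<close> is antidominant for the roots with \<open>l = 0\<close>. Linear independence of the simple roots makes
  \<open>x\<close> a natural combination of them. The part of this combination with \<open>l = 1\<close> lies in \<open>N(F)\<close>;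
  the simple roots with \<open>l = 0\<close> can then be added one at a time: as long as the remainder \<open>d\<close> of
  \<open>x = s + d\<close> is nonzero, some simple \<open>\<beta>\<close> occurring in it has \<open>d \<bullet> \<beta> > 0\<close>, hence \<open>s \<bullet> \<beta> < 0\<close> by
  antidominance, and \<open>s + \<beta>\<close> is again a sum of elements of \<open>V(F)\<close>.
\<close>

section \<open>Linear combinations with restricted coefficients\<close>

text \<open>Padding with the coefficient 0 gives all combinations one index set, so that
  coefficients can be added and scaled pointwise.\<close>

lemma lin_combs_finite:
  assumes "finite V" "0 \<in> K"
  shows "lin_combs K V = {\<Sum>v\<in>V. c v *\<^sub>R v | c. \<forall>v\<in>V. c v \<in> K}"
proof (intro equalityI subsetI)
  fix x assume "x \<in> lin_combs K V"
  then obtain S c where S: "S \<subseteq> V" "\<forall>v\<in>S. c v \<in> K" "x = (\<Sum>v\<in>S. c v *\<^sub>R v)"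
    unfolding lin_combs_def by auto
  have "x = (\<Sum>v\<in>V. (if v \<in> S then c v else 0) *\<^sub>R v)"
    unfolding S(3) by (rule sum.mono_neutral_cong_left) (use S assms in auto)
  moreover have "\<forall>v\<in>V. (if v \<in> S then c v else 0) \<in> K"
    using S assms by auto
  ultimately show "x \<in> {\<Sum>v\<in>V. c v *\<^sub>R v | c. \<forall>v\<in>V. c v \<in> K}"
    by (intro CollectI exI[of _ "\<lambda>v. if v \<in> S then c v else 0"] conjI)
next
  fix x assume "x \<in> {\<Sum>v\<in>V. c v *\<^sub>R v | c. \<forall>v\<in>V. c v \<in> K}"
  then show "x \<in> lin_combs K V"
    unfolding lin_combs_def using assms by blast
qed

lemma lin_combs_mono: "K \<subseteq> L \<Longrightarrow> lin_combs K V \<subseteq> lin_combs L V"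
  unfolding lin_combs_def by blast

lemma lin_combs_superset:
  assumes "1 \<in> K"
  shows "V \<subseteq> lin_combs K V"
proof
  fix v assume "v \<in> V"
  then show "v \<in> lin_combs K V"
    unfolding lin_combs_def using assms
    by (intro CollectI exI[of _ "{v}"] exI[of _ "\<lambda>_. 1"]) auto
qed

lemma lin_combs_add:
  assumes "finite V" "0 \<in> K" "\<And>a b. a \<in> K \<Longrightarrow> b \<in> K \<Longrightarrow> a + b \<in> K"
    and "x \<in> lin_combs K V" "y \<in> lin_combs K V"
  shows "x + y \<in> lin_combs K V"
proof -
  obtain c d where "\<forall>v\<in>V. c v \<in> K" "x = (\<Sum>v\<in>V. c v *\<^sub>R v)" "\<forall>v\<in>V. d v \<in> K" "y = (\<Sum>v\<in>V. d v *\<^sub>R v)"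
    using assms by (auto simp: lin_combs_finite)
  then show ?thesis
    using assms(3) unfolding lin_combs_finite[OF assms(1,2)]
    by (intro CollectI exI[of _ "\<lambda>v. c v + d v"]) (auto simp: scaleR_add_left sum.distrib)
qed

lemma lin_combs_scale:
  assumes "finite V" "0 \<in> K" "\<And>a. a \<in> K \<Longrightarrow> r * a \<in> K" "x \<in> lin_combs K V"
  shows "r *\<^sub>R x \<in> lin_combs K V"
proof -
  obtain c where "\<forall>v\<in>V. c v \<in> K" "x = (\<Sum>v\<in>V. c v *\<^sub>R v)"
    using assms by (auto simp: lin_combs_finite)
  then show ?thesis
    using assms(3) unfolding lin_combs_finite[OF assms(1,2)]
    by (intro CollectI exI[of _ "\<lambda>v. r * c v"]) (auto simp: scaleR_sum_right)
qed

lemma lin_combs_sum: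
  assumes "finite V" "0 \<in> K" "\<And>a b. a \<in> K \<Longrightarrow> b \<in> K \<Longrightarrow> a + b \<in> K"
    and "\<And>i. i \<in> I \<Longrightarrow> g i \<in> lin_combs K V"
  shows "(\<Sum>i\<in>I. g i) \<in> lin_combs K V"
  using assms(4)
proof (induction I rule: infinite_finite_induct)
  case (insert i I)
  then show ?case using lin_combs_add[OF assms(1-3)] by simp
qed (use assms(1,2) in \<open>auto simp: lin_combs_finite intro!: exI[of _ "\<lambda>_. 0"]\<close>)

text \<open>This carries the cone and the lattice of the face roots over to coordinates in simple
  roots.\<close>

lemma lin_combs_trans:
  assumes "finite V" "finite W" "0 \<in> K" "\<And>a b. a \<in> K \<Longrightarrow> b \<in> K \<Longrightarrow> a + b \<in> K"
    and "\<And>a b. a \<in> K \<Longrightarrow> b \<in> K \<Longrightarrow> a * b \<in> K"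
    and "V \<subseteq> lin_combs K W" "x \<in> lin_combs K V"
  shows "x \<in> lin_combs K W"
proof -
  obtain c where "\<forall>v\<in>V. c v \<in> K" "x = (\<Sum>v\<in>V. c v *\<^sub>R v)"
    using assms by (auto simp: lin_combs_finite)
  then show ?thesis
    using assms by (auto intro!: lin_combs_sum lin_combs_scale)
qed

section \<open>Sign patterns of perturbed linear forms\<close>

text \<open>The witness is \<open>a + e *\<^sub>R b\<close> with a small \<open>e > 0\<close>:
  nonzero values of \<open>a\<close> on the finite set keep their sign, and where \<open>a\<close>
  vanishes only a positive multiple of \<open>b\<close> is left.\<close>

lemma lex_refinement:
  fixes a b :: "'a::euclidean_space"
  assumes "finite A"
  shows "\<exists>c. \<forall>\<alpha>\<in>A. sgn (c \<bullet> \<alpha>) = (if a \<bullet> \<alpha> = 0 then sgn (b \<bullet> \<alpha>) else sgn (a \<bullet> \<alpha>))"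
proof -
  have lim: "((\<lambda>e. (a + e *\<^sub>R b) \<bullet> \<alpha>) \<longlongrightarrow> a \<bullet> \<alpha>) (at_right 0)" for \<alpha>
    by (rule tendsto_eq_intros refl | simp)+
  have "\<forall>\<^sub>F e in at_right 0. \<forall>\<alpha>\<in>A. a \<bullet> \<alpha> \<noteq> 0 \<longrightarrow> sgn ((a + e *\<^sub>R b) \<bullet> \<alpha>) = sgn (a \<bullet> \<alpha>)"
  proof (intro eventually_ball_finite[OF assms] ballI)
    fix \<alpha>
    show "\<forall>\<^sub>F e in at_right 0. a \<bullet> \<alpha> \<noteq> 0 \<longrightarrow> sgn ((a + e *\<^sub>R b) \<bullet> \<alpha>) = sgn (a \<bullet> \<alpha>)"
      using order_tendstoD[OF lim[of \<alpha>], of 0]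
      by (cases "a \<bullet> \<alpha>" "0::real" rule: linorder_cases) (auto elim: eventually_mono)
  qed
  then have "\<forall>\<^sub>F e::real in at_right 0. e > 0 \<and>
      (\<forall>\<alpha>\<in>A. a \<bullet> \<alpha> \<noteq> 0 \<longrightarrow> sgn ((a + e *\<^sub>R b) \<bullet> \<alpha>) = sgn (a \<bullet> \<alpha>))"
    by (intro eventually_conj eventually_at_right_less)
  then obtain e :: real where "e > 0"
    "\<forall>\<alpha>\<in>A. a \<bullet> \<alpha> \<noteq> 0 \<longrightarrow> sgn ((a + e *\<^sub>R b) \<bullet> \<alpha>) = sgn (a \<bullet> \<alpha>)"
    using eventually_happens'[OF trivial_limit_at_right_real] by blast
  then show ?thesis
    by (intro exI[of _ "a + e *\<^sub>R b"]) (auto simp: inner_add_left sgn_mult)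
qed

text \<open>Some \<open>y\<close> is orthogonal to no element of \<open>A\<close>; taken as
  tie-breaker for \<open>a\<close>, it removes all zeros.\<close>

lemma generic_refinement:
  fixes a :: "'a::euclidean_space"
  assumes "finite A" "0 \<notin> A"
  shows "\<exists>c. \<forall>\<alpha>\<in>A. c \<bullet> \<alpha> \<noteq> 0 \<and> (a \<bullet> \<alpha> \<noteq> 0 \<longrightarrow> sgn (c \<bullet> \<alpha>) = sgn (a \<bullet> \<alpha>))"
proof -
  have "\<exists>y. \<forall>\<alpha>\<in>A. y \<bullet> \<alpha> \<noteq> 0"
    using assms
  proof (induction A)
    case (insert \<beta> A)
    then obtain y where y: "\<forall>\<alpha>\<in>A. y \<bullet> \<alpha> \<noteq> 0" by auto
    \<comment> \<open>The new element \<beta> is its own tie-breaker: if \<open>y\<close> is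
      orthogonal to it, then \<open>\<beta> \<bullet> \<beta> > 0\<close> decides, while the older
      elements keep their signs.\<close>
    obtain c where c: "\<forall>\<alpha>\<in>insert \<beta> A.
        sgn (c \<bullet> \<alpha>) = (if y \<bullet> \<alpha> = 0 then sgn (\<beta> \<bullet> \<alpha>) else sgn (y \<bullet> \<alpha>))"
      using lex_refinement[of "insert \<beta> A" y \<beta>] insert.hyps(1) by auto
    have "c \<bullet> \<alpha> \<noteq> 0" if "\<alpha> \<in> insert \<beta> A" for \<alpha>
    proof -
      have "\<beta> \<bullet> \<beta> \<noteq> 0" using insert.prems by auto
      then have "sgn (c \<bullet> \<alpha>) \<noteq> 0" using c y that by (metis insert_iff sgn_zero_iff)
      then show ?thesis by auto
    qed
    then show ?case by blast
  qed auto
  then obtain y where y: "\<forall>\<alpha>\<in>A. y \<bullet> \<alpha> \<noteq> 0" by blast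
  obtain c where c: "\<forall>\<alpha>\<in>A. sgn (c \<bullet> \<alpha>) = (if a \<bullet> \<alpha> = 0 then sgn (y \<bullet> \<alpha>) else sgn (a \<bullet> \<alpha>))"
    using lex_refinement[OF assms(1)] by blast
  have "c \<bullet> \<alpha> \<noteq> 0" if "\<alpha> \<in> A" for \<alpha>
  proof -
    have "sgn (c \<bullet> \<alpha>) \<noteq> 0" using c y that by (auto simp: sgn_zero_iff)
    then show ?thesis by auto
  qed
  then show ?thesis using c by (intro exI[of _ c]) auto
qed

section \<open>Independence of vectors at obtuse angles\<close>

text \<open>Moving the terms with positive coefficients to one side of a relation writes one vector
  \<open>e\<close> in two ways. Non-acute angles give \<open>e \<bullet> e \<le> 0\<close>, so
  \<open>e = 0\<close>; but any positive coefficient would give \<open>h \<bullet> e > 0\<close>.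
  The negated relation excludes negative coefficients.\<close>

lemma obtuse_independent:
  fixes h :: "'a::euclidean_space"
  assumes fin: "finite D" and pos: "\<And>\<delta>. \<delta> \<in> D \<Longrightarrow> h \<bullet> \<delta> > 0"
    and obt: "\<And>\<delta> \<epsilon>. \<delta> \<in> D \<Longrightarrow> \<epsilon> \<in> D \<Longrightarrow> \<delta> \<noteq> \<epsilon> \<Longrightarrow> \<delta> \<bullet> \<epsilon> \<le> 0"
    and zero: "(\<Sum>\<delta>\<in>D. a \<delta> *\<^sub>R \<delta>) = 0" and "\<delta> \<in> D"
  shows "a \<delta> = 0"
proof -
  have nonpos: "b \<delta> \<le> 0" if z: "(\<Sum>\<delta>\<in>D. b \<delta> *\<^sub>R \<delta>) = 0" and "\<delta> \<in> D" for b :: "'a \<Rightarrow> real" and \<delta>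
  proof (rule ccontr)
    assume "\<not> b \<delta> \<le> 0"
    define P where "P = {\<delta>\<in>D. b \<delta> > 0}"
    define e where "e = (\<Sum>\<delta>\<in>P. b \<delta> *\<^sub>R \<delta>)"
    have "(\<Sum>\<delta>\<in>D. b \<delta> *\<^sub>R \<delta>) = (\<Sum>\<delta>\<in>D - P. b \<delta> *\<^sub>R \<delta>) + e"
      unfolding e_def by (rule sum.subset_diff) (auto simp: P_def fin)
    then have e': "e = (\<Sum>\<delta>\<in>D - P. (- b \<delta>) *\<^sub>R \<delta>)"
      using z by (simp add: sum_negf eq_neg_iff_add_eq_0 add.commute)
    have "e \<bullet> e = (\<Sum>\<delta>\<in>P. \<Sum>\<epsilon>\<in>D - P. b \<delta> * (- b \<epsilon>) * (\<delta> \<bullet> \<epsilon>))"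
      by (subst (2) e') (simp add: e_def inner_sum_left inner_sum_right sum_distrib_left mult_ac sum_negf sum.swap[of _ P])
    also have "\<dots> \<le> 0"
      by (intro sum_nonpos mult_nonneg_nonpos mult_nonneg_nonneg obt) (auto simp: P_def)
    finally have "e = 0" by (metis inner_gt_zero_iff not_le)
    moreover have "h \<bullet> e > 0"
      unfolding e_def inner_sum_right
      by (rule sum_pos) (use \<open>\<not> b \<delta> \<le> 0\<close> that fin pos in \<open>auto simp: P_def\<close>)
    ultimately show False by simp
  qed
  show ?thesis
    using nonpos[of a \<delta>] nonpos[of "\<lambda>\<delta>. - a \<delta>" \<delta>] zero \<open>\<delta> \<in> D\<close> by (auto simp: sum_negf)
qed

section \<open>Differences of roots\<close>

lemma root_uminus:
  assumes "root_system E \<Phi>" "\<alpha> \<in> \<Phi>"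
  shows "- \<alpha> \<in> \<Phi>"
proof -
  have "\<alpha> \<noteq> 0" using assms unfolding root_system_def by auto
  then have "root_reflection \<alpha> \<alpha> = - \<alpha>"
    by (simp add: root_reflection_def refl_coeff_def algebra_simps scaleR_2)
  then show ?thesis using assms unfolding root_system_def by (metis image_eqI)
qed

text \<open>By Cauchy-Schwarz the two positive Cartan integers have product at most 4. If one of
  them is 1, a reflection yields the difference up to sign; otherwise both are 2, which forces
  \<alpha> = \<beta>.\<close>

lemma root_diff:
  assumes rs: "root_system E \<Phi>" and cr: "crystallographic \<Phi>"
    and ab: "\<alpha> \<in> \<Phi>" "\<beta> \<in> \<Phi>" "\<alpha> \<bullet> \<beta> > 0" "\<alpha> \<noteq> \<beta>"
  shows "\<alpha> - \<beta> \<in> \<Phi>"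
proof -
  have *: "\<gamma> - \<delta> \<in> \<Phi>" if "\<gamma> \<in> \<Phi>" "\<delta> \<in> \<Phi>" "refl_coeff \<delta> \<gamma> = 1" for \<gamma> \<delta>
  proof -
    have "root_reflection \<delta> \<gamma> \<in> \<Phi>"
      using rs that unfolding root_system_def by blast
    then show ?thesis using that by (simp add: root_reflection_def)
  qed
  have nz: "\<alpha> \<bullet> \<alpha> > 0" "\<beta> \<bullet> \<beta> > 0"
    using rs ab unfolding root_system_def by auto
  obtain m n where mn: "refl_coeff \<beta> \<alpha> = of_int m" "refl_coeff \<alpha> \<beta> = of_int n"
    using cr ab unfolding crystallographic_def by (metis Ints_cases)
  have m: "2 * (\<alpha> \<bullet> \<beta>) = m * (\<beta> \<bullet> \<beta>)" and n: "2 * (\<alpha> \<bullet> \<beta>) = n * (\<alpha> \<bullet> \<alpha>)"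
    using mn nz by (auto simp: refl_coeff_def field_simps inner_commute)
  have "m > 0" "n > 0"
    using m n nz ab(3) by (smt (verit) mult_nonpos_nonneg of_int_le_0_iff)+
  have "4 * (\<alpha> \<bullet> \<beta>)\<^sup>2 = (m * n) * ((\<alpha> \<bullet> \<alpha>) * (\<beta> \<bullet> \<beta>))"
    using arg_cong2[OF m n, of "(*)"] by (simp add: power2_eq_square mult_ac)
  moreover have "(\<alpha> \<bullet> \<beta>)\<^sup>2 \<le> (\<alpha> \<bullet> \<alpha>) * (\<beta> \<bullet> \<beta>)"
    by (rule Cauchy_Schwarz_ineq)
  ultimately have "of_int (m * n) * ((\<alpha> \<bullet> \<alpha>) * (\<beta> \<bullet> \<beta>)) \<le> 4 * ((\<alpha> \<bullet> \<alpha>) * (\<beta> \<bullet> \<beta>))"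
    by simp
  then have "real_of_int (m * n) \<le> 4"
    using nz by (metis mult_pos_pos mult_le_cancel_right_pos)
  then have mn4: "m * n \<le> 4" by linarith
  consider "m = 1" | "n = 1" | "m \<ge> 2" "n \<ge> 2"
    using \<open>m > 0\<close> \<open>n > 0\<close> by linarith
  then show ?thesis
  proof cases
    case 1
    then show ?thesis using * ab mn by simp
  next
    case 2
    then have "\<beta> - \<alpha> \<in> \<Phi>" using * ab mn by simp
    then show ?thesis using root_uminus[OF rs] by fastforce
  next
    case 3
    then have "m * 2 \<le> m * n" "2 * n \<le> m * n"
      by (simp_all add: mult_left_mono mult_right_mono)
    with mn4 3 have "m = 2" "n = 2" by linarith+
    with m n have "(\<alpha> - \<beta>) \<bullet> (\<alpha> - \<beta>) = 0"
      by (simp add: inner_diff_left inner_diff_right inner_commute)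
    then show ?thesis using ab by simp
  qed
qed

section \<open>Absorbing further roots into a natural combination\<close>

text \<open>Some summand \<open>v\<close> of \<open>s\<close> must satisfy
  \<open>v \<bullet> \<beta> < 0\<close>; one copy of it is traded for
  \<open>v + \<beta>\<close>.\<close>

lemma nat_span_add_root:
  fixes V :: "'a::euclidean_space set"
  assumes "finite V" "s \<in> nat_span V" "s \<bullet> \<beta> < 0"
    and step: "\<And>v. v \<in> V \<Longrightarrow> v \<bullet> \<beta> < 0 \<Longrightarrow> v + \<beta> \<in> V"
  shows "s + \<beta> \<in> nat_span V"
proof -
  obtain c where c: "\<forall>v\<in>V. c v \<in> \<nat>" and s: "s = (\<Sum>v\<in>V. c v *\<^sub>R v)"
    using assms(1,2) by (auto simp: nat_span_def lin_combs_finite)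
  have "\<exists>v\<in>V. c v * (v \<bullet> \<beta>) < 0"
    using assms(3) sum_nonneg[of V "\<lambda>v. c v * (v \<bullet> \<beta>)"]
    by (force simp: s inner_sum_left not_le)
  then obtain v where v: "v \<in> V" "c v * (v \<bullet> \<beta>) < 0" by blast
  have "c v \<ge> 0" using c v(1) by (metis Nats_cases of_nat_0_le_iff)
  with v have vb: "v \<bullet> \<beta> < 0" "c v \<noteq> 0" by (auto simp: mult_less_0_iff)
  then obtain n where n: "c v = real (Suc n)"
    using c v by (metis Nats_cases not0_implies_Suc of_nat_0)
  have "s - v = (\<Sum>w\<in>V. (c(v := real n)) w *\<^sub>R w)"
    unfolding s using assms(1) v(1) by (simp add: sum.remove[of V v] n algebra_simps)
  moreover have "\<forall>w\<in>V. (c(v := real n)) w \<in> \<nat>"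
    using c by auto
  ultimately have "s - v \<in> nat_span V"
    unfolding nat_span_def lin_combs_finite[OF assms(1) Nats_0] by blast
  moreover have "v + \<beta> \<in> nat_span V"
    using step[OF v(1) vb(1)] lin_combs_superset[of \<nat> V] by (auto simp: nat_span_def)
  ultimately have "(s - v) + (v + \<beta>) \<in> nat_span V"
    unfolding nat_span_def using assms(1) by (intro lin_combs_add[of V \<nat> "s - v"]) auto
  then show ?thesis by simp
qed

lemma nat_span_climb:
  fixes V B :: "'a::euclidean_space set" and b :: "'a \<Rightarrow> nat"
  assumes "finite V" "finite B" "s \<in> nat_span V" "x = s + (\<Sum>\<beta>\<in>B. real (b \<beta>) *\<^sub>R \<beta>)"
    and anti: "\<And>\<beta>. \<beta> \<in> B \<Longrightarrow> x \<bullet> \<beta> \<le> 0"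
    and step: "\<And>v \<beta>. v \<in> V \<Longrightarrow> \<beta> \<in> B \<Longrightarrow> v \<bullet> \<beta> < 0 \<Longrightarrow> v + \<beta> \<in> V"
  shows "x \<in> nat_span V"
  using assms(3,4)
\<comment> \<open>The measure counts the elements of \<open>B\<close>, with multiplicity, not yet
  absorbed into \<open>s\<close>. The vector \<open>x\<close> stays fixed, so \<open>anti\<close>
  survives every move.\<close>
proof (induction "sum b B" arbitrary: s b rule: less_induct)
  case less
  define d where "d = (\<Sum>\<beta>\<in>B. real (b \<beta>) *\<^sub>R \<beta>)"
  show ?case
  proof (cases "d = 0")
    case True
    then show ?thesis using less.prems by (simp add: d_def)
  next
    case False
    \<comment> \<open>Expanding one factor of \<open>d \<bullet> d\<close> finds a \<beta> that
      still occurs in \<open>d\<close> and has positive product with it.\<close>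
    then have "d \<bullet> d > 0" by simp
    then have "(\<Sum>\<beta>\<in>B. real (b \<beta>) * (\<beta> \<bullet> d)) > 0"
      by (subst (asm) d_def) (simp add: inner_sum_left)
    then have "\<exists>\<beta>\<in>B. real (b \<beta>) * (\<beta> \<bullet> d) > 0"
      using sum_nonpos[of B "\<lambda>\<beta>. real (b \<beta>) * (\<beta> \<bullet> d)"] by (force simp: not_le)
    then obtain \<beta> where \<beta>: "\<beta> \<in> B" "real (b \<beta>) * (\<beta> \<bullet> d) > 0" by blast
    then have db: "d \<bullet> \<beta> > 0" "b \<beta> > 0"
      by (auto simp: zero_less_mult_iff inner_commute)
    have "s = x - d" using less.prems by (simp add: d_def)
    then have "s \<bullet> \<beta> < 0" using db anti[OF \<beta>(1)] by (simp add: inner_diff_left)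
    then have "s + \<beta> \<in> nat_span V"
      using nat_span_add_root assms(1) less.prems(1) step \<beta>(1) by blast
    moreover have "x = (s + \<beta>) + (\<Sum>\<gamma>\<in>B. real ((b(\<beta> := b \<beta> - 1)) \<gamma>) *\<^sub>R \<gamma>)"
      using less.prems(2) assms(2) \<beta>(1) db(2)
      by (simp add: sum.remove[of B \<beta>] of_nat_diff algebra_simps)
    moreover have "sum (b(\<beta> := b \<beta> - 1)) B < sum b B"
      using assms(2) \<beta>(1) db(2) by (intro sum_strict_mono_ex1) auto
    ultimately show ?thesis using less.hyps by blast
  qed
qed

section \<open>Simple roots\<close>

text \<open>\<open>D\<close> collects the indecomposable elements of \<open>P\<close>. Two distinct
  ones never form an acute angle, since their difference, in \<open>P\<close> up to sign, would
  decompose one of them; independence follows from the obtuse angles.\<close>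

lemma simple_roots:
  fixes h :: "'a::euclidean_space"
  assumes fin: "finite P" and pos: "\<And>\<alpha>. \<alpha> \<in> P \<Longrightarrow> h \<bullet> \<alpha> > 0"
    and diff: "\<And>\<alpha> \<beta>. \<alpha> \<in> P \<Longrightarrow> \<beta> \<in> P \<Longrightarrow> \<alpha> \<bullet> \<beta> > 0 \<Longrightarrow> \<alpha> \<noteq> \<beta> \<Longrightarrow> \<alpha> - \<beta> \<in> P \<or> \<beta> - \<alpha> \<in> P"
  obtains D where "D \<subseteq> P" "P \<subseteq> nat_span D"
    "\<And>a \<delta>. (\<Sum>\<delta>\<in>D. a \<delta> *\<^sub>R \<delta>) = 0 \<Longrightarrow> \<delta> \<in> D \<Longrightarrow> a \<delta> = 0"
proof -
  define D where "D = {\<alpha>\<in>P. \<not> (\<exists>\<beta>\<in>P. \<exists>\<gamma>\<in>P. \<alpha> = \<beta> + \<gamma>)}"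
  have finD: "finite D" using fin by (simp add: D_def)
  have "\<alpha> \<in> nat_span D" if "\<alpha> \<in> P" for \<alpha>
    using that
  \<comment> \<open>Heights \<open>h \<bullet> \<alpha>\<close> are real numbers, so the induction
    counts the elements of smaller height instead.\<close>
  proof (induction "card {\<beta>\<in>P. h \<bullet> \<beta> < h \<bullet> \<alpha>}" arbitrary: \<alpha> rule: less_induct)
    case less
    show ?case
    proof (cases "\<alpha> \<in> D")
      case True
      then show ?thesis using lin_combs_superset[of \<nat> D] by (auto simp: nat_span_def)
    next
      case False
      then obtain \<beta> \<gamma> where bg: "\<beta> \<in> P" "\<gamma> \<in> P" "\<alpha> = \<beta> + \<gamma>"
        using less.prems by (auto simp: D_def)
      have smaller: "card {\<zeta>\<in>P. h \<bullet> \<zeta> < h \<bullet> \<eta>} < card {\<zeta>\<in>P. h \<bullet> \<zeta> < h \<bullet> \<alpha>}"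
        if "\<eta> \<in> P" "h \<bullet> \<eta> < h \<bullet> \<alpha>" for \<eta>
        using that fin by (intro psubset_card_mono) auto
      have "\<beta> \<in> nat_span D" "\<gamma> \<in> nat_span D"
        using less.hyps[OF smaller] bg pos by (auto simp: inner_add_right)
      then show ?thesis
        unfolding bg(3) nat_span_def using finD by (intro lin_combs_add) auto
    qed
  qed
  moreover have "\<delta> \<bullet> \<epsilon> \<le> 0" if "\<delta> \<in> D" "\<epsilon> \<in> D" "\<delta> \<noteq> \<epsilon>" for \<delta> \<epsilon>
  proof (rule ccontr)
    assume "\<not> \<delta> \<bullet> \<epsilon> \<le> 0"
    then have "\<delta> - \<epsilon> \<in> P \<or> \<epsilon> - \<delta> \<in> P" using diff that by (auto simp: D_def)
    moreover have "\<delta> = \<epsilon> + (\<delta> - \<epsilon>)" "\<epsilon> = \<delta> + (\<epsilon> - \<delta>)" by auto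
    ultimately show False using that unfolding D_def by blast
  qed
  moreover have "D \<subseteq> P" by (auto simp: D_def)
  ultimately show ?thesis
    using obtuse_independent[OF finD, of h] pos by (intro that[of D]) blast+
qed

section \<open>Faces on a hyperplane missing the origin\<close>

lemma level_roots_normal:
  fixes \<Phi> :: "'a::euclidean_space set"
  assumes rs: "root_system E \<Phi>" and cr: "crystallographic \<Phi>"
    and le1: "\<And>\<alpha>. \<alpha> \<in> \<Phi> \<Longrightarrow> l \<bullet> \<alpha> \<le> 1"
    and V: "V = {\<alpha>\<in>\<Phi>. l \<bullet> \<alpha> = 1}"
    and xC: "x \<in> rat_cone V" and xZ: "x \<in> int_span V"
  shows "x \<in> nat_span V"
proof -
  have fin: "finite \<Phi>" and nz: "0 \<notin> \<Phi>" using rs by (auto simp: root_system_def)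
  have finV: "finite V" using fin V by simp
  \<comment> \<open>On \<Phi> itself \<open>l\<close> may take fractional values. Elements of the
    lattice of \<open>V\<close> have integral level, and symmetry bounds the level of a root by 1 in
    absolute value.\<close>
  define \<Psi> where "\<Psi> = \<Phi> \<inter> int_span V"
  have fin\<Psi>: "finite \<Psi>" "0 \<notin> \<Psi>" using fin nz by (auto simp: \<Psi>_def)
  have Zadd: "u + w \<in> int_span V" if "u \<in> int_span V" "w \<in> int_span V" for u w
    using that finV unfolding int_span_def by (intro lin_combs_add) auto
  have Zneg: "- u \<in> int_span V" if "u \<in> int_span V" for u
    using lin_combs_scale[OF finV, of \<int> "-1" u] that by (auto simp: int_span_def)
  have V\<Psi>: "V \<subseteq> \<Psi>"
    using V lin_combs_superset[of \<int> V] by (auto simp: \<Psi>_def int_span_def)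
  have neg\<Psi>: "- \<alpha> \<in> \<Psi>" if "\<alpha> \<in> \<Psi>" for \<alpha>
    using that root_uminus[OF rs] Zneg by (auto simp: \<Psi>_def)
  have diff\<Psi>: "\<alpha> - \<beta> \<in> \<Psi>" if "\<alpha> \<in> \<Psi>" "\<beta> \<in> \<Psi>" "\<alpha> \<bullet> \<beta> > 0" "\<alpha> \<noteq> \<beta>" for \<alpha> \<beta>
    using that root_diff[OF rs cr] Zadd[of \<alpha> "- \<beta>"] Zneg by (auto simp: \<Psi>_def)
  have level: "l \<bullet> \<alpha> \<in> {-1, 0, 1}" if \<alpha>: "\<alpha> \<in> \<Psi>" for \<alpha>
  proof -
    obtain c where c: "\<forall>v\<in>V. c v \<in> \<int>" "\<alpha> = (\<Sum>v\<in>V. c v *\<^sub>R v)"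
      using \<alpha> finV by (auto simp: \<Psi>_def int_span_def lin_combs_finite)
    then have "l \<bullet> \<alpha> = (\<Sum>v\<in>V. c v)" by (simp add: inner_sum_right V)
    then have "l \<bullet> \<alpha> \<in> \<int>" using c by auto
    moreover have "l \<bullet> \<alpha> \<le> 1" "- (l \<bullet> \<alpha>) \<le> 1"
      using le1[of \<alpha>] le1[of "- \<alpha>"] that neg\<Psi>[OF that] by (auto simp: \<Psi>_def)
    ultimately show ?thesis by (auto elim!: Ints_cases)
  qed

  \<comment> \<open>\<open>c\<close> puts level 1 on the positive side, level -1 on the negative
    side, and orders level 0 by \<open>- x\<close>. The vector \<open>h\<close> only breaks the
    remaining ties.\<close>
  obtain c where c: "\<forall>\<alpha>\<in>\<Psi>. sgn (c \<bullet> \<alpha>) = (if l \<bullet> \<alpha> = 0 then sgn ((- x) \<bullet> \<alpha>) else sgn (l \<bullet> \<alpha>))"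
    using lex_refinement[OF fin\<Psi>(1)] by blast
  obtain h where h: "\<forall>\<alpha>\<in>\<Psi>. h \<bullet> \<alpha> \<noteq> 0 \<and> (c \<bullet> \<alpha> \<noteq> 0 \<longrightarrow> sgn (h \<bullet> \<alpha>) = sgn (c \<bullet> \<alpha>))"
    using generic_refinement[OF fin\<Psi>] by blast
  define P where "P = {\<alpha>\<in>\<Psi>. h \<bullet> \<alpha> > 0}"
  have VP: "V \<subseteq> P"
  proof
    fix v assume "v \<in> V"
    with V\<Psi> c have "v \<in> \<Psi>" "sgn (c \<bullet> v) = 1" by (auto simp: V)
    with h have "sgn (h \<bullet> v) = 1" by (metis sgn_zero zero_neq_one)
    with \<open>v \<in> \<Psi>\<close> show "v \<in> P" by (simp add: P_def sgn_1_pos)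
  qed
  have P_sgn: "c \<bullet> \<alpha> \<ge> 0" if "\<alpha> \<in> P" for \<alpha>
  proof (rule ccontr)
    assume *: "\<not> c \<bullet> \<alpha> \<ge> 0"
    with h that have "sgn (h \<bullet> \<alpha>) = sgn (c \<bullet> \<alpha>)" by (auto simp: P_def)
    with * that show False by (auto simp: P_def)
  qed
  have P_level: "l \<bullet> \<alpha> = 0 \<or> \<alpha> \<in> V" if "\<alpha> \<in> P" for \<alpha>
  proof -
    have "\<alpha> \<in> \<Psi>" using that by (simp add: P_def)
    moreover have "l \<bullet> \<alpha> \<noteq> -1"
      using c P_sgn[OF that] \<open>\<alpha> \<in> \<Psi>\<close> by (auto simp: sgn_1_neg)
    ultimately show ?thesis using level[of \<alpha>] by (auto simp: V \<Psi>_def)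
  qed
  have P_anti: "x \<bullet> \<alpha> \<le> 0" if "\<alpha> \<in> P" "l \<bullet> \<alpha> = 0" for \<alpha>
  proof -
    have "sgn (c \<bullet> \<alpha>) = sgn (- (x \<bullet> \<alpha>))"
      using c that by (simp add: P_def)
    then show ?thesis using P_sgn[OF that(1)] by (metis neg_0_le_iff_le zero_le_sgn_iff)
  qed

  obtain D where DP: "D \<subseteq> P" and PD: "P \<subseteq> nat_span D"
    and indep: "\<And>a \<delta>. (\<Sum>\<delta>\<in>D. a \<delta> *\<^sub>R \<delta>) = 0 \<Longrightarrow> \<delta> \<in> D \<Longrightarrow> a \<delta> = 0"
  proof (rule simple_roots[of P h])
    fix \<alpha> \<beta> assume *: "\<alpha> \<in> P" "\<beta> \<in> P" "\<alpha> \<bullet> \<beta> > 0" "\<alpha> \<noteq> \<beta>"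
    then have "\<alpha> - \<beta> \<in> \<Psi>" "\<beta> - \<alpha> \<in> \<Psi>" using diff\<Psi> by (auto simp: P_def inner_commute)
    \<comment> \<open>As \<open>h\<close> vanishes on no root of \<Psi>, one of the two opposite
      differences is positive.\<close>
    moreover have "h \<bullet> (\<alpha> - \<beta>) \<noteq> 0" using h calculation by blast
    ultimately show "\<alpha> - \<beta> \<in> P \<or> \<beta> - \<alpha> \<in> P" by (auto simp: P_def inner_diff_right)
  qed (use fin\<Psi> in \<open>auto simp: P_def\<close>)
  have finD: "finite D" using DP fin\<Psi> by (auto simp: P_def intro: finite_subset)

  have VD: "V \<subseteq> lin_combs K D" if "\<nat> \<subseteq> K" for K
    using VP PD lin_combs_mono[OF that] by (force simp: nat_span_def)
  have Rats: "(\<nat> :: real set) \<subseteq> {q \<in> \<rat>. 0 \<le> q}" by (auto elim: Nats_cases)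
  \<comment> \<open>Two expansions of \<open>x\<close> over \<open>D\<close> are compared: the cone
    gives nonnegative coefficients, the lattice integral ones. Independence identifies them, so they
    are natural numbers.\<close>
  have "x \<in> lin_combs {q \<in> \<rat>. 0 \<le> q} D"
    by (rule lin_combs_trans[OF finV finD]) (use xC VD[OF Rats] in \<open>auto simp: rat_cone_def\<close>)
  then obtain a where a: "\<forall>\<delta>\<in>D. a \<delta> \<ge> 0" "x = (\<Sum>\<delta>\<in>D. a \<delta> *\<^sub>R \<delta>)"
    using finD by (auto simp: lin_combs_finite)
  have "x \<in> lin_combs \<int> D"
    by (rule lin_combs_trans[OF finV finD]) (use xZ VD[OF Nats_subset_Ints] in \<open>auto simp: int_span_def\<close>)
  then obtain b where b: "\<forall>\<delta>\<in>D. b \<delta> \<in> \<int>" "x = (\<Sum>\<delta>\<in>D. b \<delta> *\<^sub>R \<delta>)"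
    using finD by (auto simp: lin_combs_finite)
  have "(\<Sum>\<delta>\<in>D. (a \<delta> - b \<delta>) *\<^sub>R \<delta>) = 0"
    using a b by (simp add: scaleR_diff_left sum_subtractf)
  then have ab: "a \<delta> = b \<delta>" if "\<delta> \<in> D" for \<delta>
    using indep[of "\<lambda>\<delta>. a \<delta> - b \<delta>"] that by auto
  have "\<forall>\<delta>\<in>D. a \<delta> \<in> \<nat>"
    using ab a(1) b(1) by (simp add: Nats_altdef2)
  then have "\<forall>\<delta>\<in>D. \<exists>n. a \<delta> = real n"
    by (simp add: Nats_def image_iff)
  then obtain n where n: "\<forall>\<delta>\<in>D. a \<delta> = real (n \<delta>)" by metis

  \<comment> \<open>By \<open>P_level\<close>, the simple roots outside \<open>V\<close> are exactly
    those of level 0.\<close>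
  define B where "B = D - V"
  define s where "s = (\<Sum>\<delta>\<in>D \<inter> V. real (n \<delta>) *\<^sub>R \<delta>)"
  have "x = (\<Sum>\<delta>\<in>D. real (n \<delta>) *\<^sub>R \<delta>)" using a n by simp
  also have "\<dots> = s + (\<Sum>\<beta>\<in>B. real (n \<beta>) *\<^sub>R \<beta>)"
    unfolding s_def B_def by (rule sum.Int_Diff[OF finD])
  finally have x: "x = s + (\<Sum>\<beta>\<in>B. real (n \<beta>) *\<^sub>R \<beta>)" .
  have B: "\<beta> \<in> \<Psi>" "l \<bullet> \<beta> = 0" "x \<bullet> \<beta> \<le> 0" if "\<beta> \<in> B" for \<beta>
    using that DP P_level P_anti by (auto simp: B_def P_def)
  have s: "s \<in> nat_span V"
    unfolding s_def nat_span_def lin_combs_def using finD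
    by (intro CollectI exI[of _ "D \<inter> V"] exI[of _ "\<lambda>\<delta>. real (n \<delta>)"]) auto
  show ?thesis
  proof (rule nat_span_climb[OF finV _ s x])
    fix v \<beta> assume v: "v \<in> V" "\<beta> \<in> B" "v \<bullet> \<beta> < 0"
    have lv: "l \<bullet> v = 1" using v V by simp
    \<comment> \<open>The levels 1 and 0 differ, so \<open>diff\<Psi>\<close> applies to
      \<open>v\<close> and \<open>- \<beta>\<close>, which form an acute angle; adding \<beta> keeps
      the level at 1.\<close>
    have "v \<noteq> - \<beta>" using lv B(2)[OF v(2)] by auto
    then have "v - (- \<beta>) \<in> \<Psi>"
      using v V\<Psi> B(1) neg\<Psi> by (intro diff\<Psi>) auto
    then show "v + \<beta> \<in> V" using lv B(2)[OF v(2)] by (simp add: V \<Psi>_def inner_add_right)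
  qed (use B finD in \<open>auto simp: B_def\<close>)
qed

section \<open>The whole polytope, and the theorem\<close>

text \<open>A negative coefficient of \<open>v\<close> is a positive coefficient of
  \<open>- v\<close>.\<close>

lemma symmetric_int_span_subset_nat_span:
  assumes "finite V" "\<And>v. v \<in> V \<Longrightarrow> - v \<in> V"
  shows "int_span V \<subseteq> nat_span V"
proof
  fix x assume "x \<in> int_span V"
  then obtain c where c: "\<forall>v\<in>V. c v \<in> \<int>" "x = (\<Sum>v\<in>V. c v *\<^sub>R v)"
    using assms(1) by (auto simp: int_span_def lin_combs_finite)
  have N: "k *\<^sub>R v \<in> nat_span V" if "k \<in> \<nat>" "v \<in> V" for k v
    unfolding nat_span_def lin_combs_def using that
    by (intro CollectI exI[of _ "{v}"] exI[of _ "\<lambda>_. k"]) auto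
  have "c v *\<^sub>R v \<in> nat_span V" if "v \<in> V" for v
  proof (cases "c v \<ge> 0")
    case True
    then show ?thesis using c that N by (simp add: Nats_altdef2)
  next
    case False
    then have "- c v \<in> \<nat>" using c that by (simp add: Nats_altdef2)
    then show ?thesis using N[of "- c v" "- v"] that assms(2) by simp
  qed
  then show "x \<in> nat_span V"
    unfolding c(2) nat_span_def by (intro lin_combs_sum assms(1)) auto
qed

theorem corollaryC:
  fixes E \<Phi> F :: "'a::euclidean_space set"
  assumes "root_system E \<Phi>" and "crystallographic \<Phi>" and "reduced_roots \<Phi>"
    and "F face_of root_polytope \<Phi>"
  shows "normal_face \<Phi> F"
proof -
  define V where "V = face_roots \<Phi> F"
  have fin: "finite \<Phi>" using assms(1) by (simp add: root_system_def)
  have hull: "\<Phi> \<subseteq> root_polytope \<Phi>" by (simp add: root_polytope_def hull_subset)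
  \<comment> \<open>Every face of a polyhedron is exposed, which supplies a supporting
    hyperplane.\<close>
  have "polyhedron (root_polytope \<Phi>)"
    unfolding root_polytope_def using fin by (rule polyhedron_convex_hull)
  then have "F exposed_face_of root_polytope \<Phi>"
    using assms(4) by (simp add: exposed_face_of_polyhedron)
  then obtain a b where sub: "root_polytope \<Phi> \<subseteq> {y. a \<bullet> y \<le> b}"
    and F: "F = root_polytope \<Phi> \<inter> {y. a \<bullet> y = b}"
    unfolding exposed_face_of_def by blast
  have le: "a \<bullet> \<alpha> \<le> b" if "\<alpha> \<in> \<Phi>" for \<alpha> using hull sub that by blast
  have V: "V = {\<alpha>\<in>\<Phi>. a \<bullet> \<alpha> = b}" using hull by (auto simp: V_def face_roots_def F)
  have "x \<in> nat_span V" if x: "x \<in> rat_cone V" "x \<in> int_span V" for x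
  proof (cases "b > 0")
    case True
    show ?thesis
      by (rule level_roots_normal[OF assms(1,2) _ _ x, of "a /\<^sub>R b"])
        (use True le V in \<open>auto simp: field_simps\<close>)
  next
    case False
    \<comment> \<open>With \<open>b \<le> 0\<close>, the bound for both \<alpha> and its negative
      leaves only \<open>a \<bullet> \<alpha> = b = 0\<close>. If \<Phi> is empty, the claim is
      vacuous.\<close>
    have "a \<bullet> \<alpha> = b" if "\<alpha> \<in> \<Phi>" for \<alpha>
      using le[OF that] le[OF root_uminus[OF assms(1) that]] False by simp
    then have "V = \<Phi>" using V by auto
    then show ?thesis
      using symmetric_int_span_subset_nat_span[OF fin root_uminus[OF assms(1)]] x by blast
  qed
  moreover have "nat_span V \<subseteq> rat_cone V"
    unfolding nat_span_def rat_cone_def by (rule lin_combs_mono) (auto elim: Nats_cases)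
  moreover have "nat_span V \<subseteq> int_span V"
    unfolding nat_span_def int_span_def by (rule lin_combs_mono) (rule Nats_subset_Ints)
  ultimately show ?thesis unfolding normal_face_def V_def by blast
qed

end
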